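(* Let $\mathcal{K}\subset\mathbb{R}^n$ be a compact convex set, symmetric about the origin, and let $\zeta$ be uniformly distributed on $\mathcal{K}$. For $\mathbf{x}\in\mathbb{R}^n$ let $\mathbf{K}(\mathbf{x})=\{\zeta\in\mathcal{K} : c(\mathbf{x},\zeta)\ge 0\}$ with $c(\mathbf{x},\zeta)=1-|\zeta^{T}\mathbf{x}|^2$. Then $$\mathbb{P}\{\zeta : \zeta\in\mathbf{K}(\mathbf{x})\}=\mathbb{E}_{\tilde p}[F(\mathbf{x},\xi)]=\int_{\mathbb{R}^n}F(\mathbf{x},\xi)\,\tilde p(\xi)\,d\xi,$$ where $$F(\mathbf{x},\xi)=\mathcal{C}_{\mathcal{K}}(2\pi)^{n/2}\exp\Big(-\max\{|\xi^{T}\mathbf{x}|^2,\|\xi\|_{\mathcal{K}}^2\}+\tfrac12\|\xi\|_{\mathcal{K}}^2\Big),\qquad \tilde p(\xi)=\frac{1}{(2\pi)^{n/2}D_{\mathcal{K}}}e^{-\|\xi\|_{\mathcal{K}}^2/2},$$ $\mathcal{C}=\frac{1}{\mathrm{Vol}(\mathcal{K})}\frac{1}{\Gamma(1+n/2)}$, $D_{\mathcal{K}}>0$ is the scalar for which $\int_{\mathbb{R}^n}\tilde p(\xi)\,d\xi=1$, and $\mathcal{C}_{\mathcal{K}}=\mathcal{C}\,D_{\mathcal{K}}$.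
   Context: $\|\zeta\|_{\mathcal{K}}=\inf\{t>0:\zeta/t\in\mathcal{K}\}$ is the Minkowski functional of $\mathcal{K}$. $\mathrm{Vol}$ denotes Lebesgue measure on $\mathbb{R}^n$; since $\zeta$ is uniformly distributed on $\mathcal{K}$, $\mathrm{Vol}(\mathcal{K})>0$. $\Gamma$ is the Gamma function. *)

theory Defs
  imports "HOL-Probability.Probability"
begin

definition minkowski_functional :: "(real ^ 'n) set \<Rightarrow> real ^ 'n \<Rightarrow> real" where
  "minkowski_functional K z = Inf {t. t > 0 \<and> z /\<^sub>R t \<in> K}"

definition constraint_fun :: "real ^ 'n \<Rightarrow> real ^ 'n \<Rightarrow> real" where
  "constraint_fun x z = 1 - \<bar>z \<bullet> x\<bar>\<^sup>2"

definition feasible_set :: "(real ^ 'n) set \<Rightarrow> real ^ 'n \<Rightarrow> (real ^ 'n) set" where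
  "feasible_set K x = {z \<in> K. constraint_fun x z \<ge> 0}"

definition gauge_gaussian :: "(real ^ 'n) set \<Rightarrow> real \<Rightarrow> real ^ 'n \<Rightarrow> real" where
  "gauge_gaussian K D \<xi> =
     1 / ((2 * pi) powr (real CARD('n) / 2) * D) * exp (- (minkowski_functional K \<xi>)\<^sup>2 / 2)"

text \<open>
  The integral of a function that is not integrable is 0 by convention, so the value 1 below
  includes integrability. The definite description is meaningful only if such a scalar exists
  and is unique.
\<close>

definition is_normalizer :: "(real ^ 'n) set \<Rightarrow> real \<Rightarrow> bool" where
  "is_normalizer K D \<longleftrightarrow> D > 0 \<and> (\<integral>\<xi>. gauge_gaussian K D \<xi> \<partial>lborel) = 1"

definition normalizer :: "(real ^ 'n) set \<Rightarrow> real" where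
  "normalizer K = (THE D. is_normalizer K D)"

definition p_tilde :: "(real ^ 'n) set \<Rightarrow> real ^ 'n \<Rightarrow> real" where
  "p_tilde K = gauge_gaussian K (normalizer K)"

definition C_vol :: "(real ^ 'n) set \<Rightarrow> real" where
  "C_vol K = 1 / measure lborel K * (1 / Gamma (1 + real CARD('n) / 2))"

definition C_body :: "(real ^ 'n) set \<Rightarrow> real" where
  "C_body K = C_vol K * normalizer K"

definition F_integrand :: "(real ^ 'n) set \<Rightarrow> real ^ 'n \<Rightarrow> real ^ 'n \<Rightarrow> real" where
  "F_integrand K x \<xi> =
     C_body K * (2 * pi) powr (real CARD('n) / 2) *
     exp (- max (\<bar>\<xi> \<bullet> x\<bar>\<^sup>2) ((minkowski_functional K \<xi>)\<^sup>2)
          + 1 / 2 * (minkowski_functional K \<xi>)\<^sup>2)"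

end

theory Submission
  imports Defs
begin

text \<open>
  The product \<open>F * p_tilde\<close> is \<open>C_vol K * exp (- N\<^sup>2)\<close>, where
  \<open>N = max \<bar>\<xi> \<bullet> x\<bar> \<parallel>\<xi>\<parallel>\<close> is the gauge of the feasible set. For every gauge \<open>N\<close> with unit
  ball \<open>L\<close>, the layer-cake formula \<open>exp (- N\<^sup>2) = \<integral> [N\<^sup>2 \<le> s] exp (- s) ds\<close> and the scaling
  \<open>Vol {N\<^sup>2 \<le> s} = s powr (n / 2) * Vol L\<close> give
  \<open>\<integral> exp (- N\<^sup>2) = Vol L * Gamma (1 + n / 2)\<close>. The same formula for the gauge
  \<open>\<parallel>\<xi>\<parallel> / sqrt 2\<close> yields the normalizing constant.
\<close>

section \<open>Integrals of exp (- N^2) by layers\<close>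

lemma nn_integral_exp_minus_atLeast:
  fixes a :: real
  shows "(\<integral>\<^sup>+s. ennreal (if a \<le> s then exp (- s) else 0) \<partial>lborel) = ennreal (exp (- a))"
proof -
  have "(\<integral>\<^sup>+s. ennreal (exp (- s)) * indicator {a..} s \<partial>lborel) = ennreal (0 - (- exp (- a)))"
  proof (rule nn_integral_FTC_atLeast)
    show "((\<lambda>s. - exp (- s)) \<longlongrightarrow> (0::real)) at_top"
      using tendsto_minus[OF filterlim_compose[OF exp_at_bot filterlim_uminus_at_bot_at_top]]
      by simp
  qed (auto intro!: derivative_eq_intros)
  moreover have "(\<lambda>s. ennreal (if a \<le> s then exp (- s) else 0)) =
      (\<lambda>s. ennreal (exp (- s)) * indicator {a..} s)"
    by (auto simp: fun_eq_iff indicator_def)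
  ultimately show ?thesis by simp
qed

lemma emeasure_lborel_scaled_preimage:
  fixes L :: "'a::euclidean_space set"
  assumes [measurable]: "L \<in> sets borel" and t: "t > 0"
  shows "emeasure lborel {z. z /\<^sub>R t \<in> L} = ennreal (t ^ DIM('a)) * emeasure lborel L"
proof -
  have eq: "{z. z /\<^sub>R t \<in> L} = (\<lambda>z. t *\<^sub>R z + 0) ` L"
  proof safe
    fix z assume "z /\<^sub>R t \<in> L"
    then show "z \<in> (\<lambda>z. t *\<^sub>R z + 0) ` L"
      using t by (intro image_eqI[where x="z /\<^sub>R t"]) auto
  qed (use t in auto)
  have "{z. z /\<^sub>R t \<in> L} \<in> sets borel" by measurable
  then have "emeasure lborel {z. z /\<^sub>R t \<in> L} = emeasure lebesgue {z. z /\<^sub>R t \<in> L}"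
    by simp
  also have "\<dots> = \<bar>t\<bar> ^ DIM('a) * emeasure lebesgue L"
    unfolding eq by (rule emeasure_lebesgue_affine)
  finally show ?thesis using t assms by simp
qed

text \<open>\<open>N\<close> enters only through its sublevel sets, so that one lemma serves both
  \<open>minkowski_functional K\<close> divided by \<open>sqrt 2\<close> and the maximum that
  describes the feasible set.\<close>

lemma nn_integral_exp_minus_gauge_square:
  fixes L :: "'a::euclidean_space set" and N :: "'a \<Rightarrow> real"
  assumes [measurable]: "L \<in> sets borel" "N \<in> borel_measurable borel"
    and nonneg: "\<And>z. N z \<ge> 0"
    and sublevel: "\<And>t z. t > 0 \<Longrightarrow> N z \<le> t \<longleftrightarrow> z /\<^sub>R t \<in> L"
  shows "(\<integral>\<^sup>+z. ennreal (exp (- (N z)\<^sup>2)) \<partial>lborel) =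
    ennreal (Gamma (1 + real DIM('a) / 2)) * emeasure lborel L"
proof -
  let ?n = "real DIM('a)"
  \<comment> \<open>The exponent \<open>1 + ?n / 2 - 1\<close> matches the integrand of the Gamma
    integral. The level \<open>s = 0\<close> is left out because \<open>sublevel\<close> speaks only
    of positive \<open>t\<close>; a single level is a null set.\<close>
  have slice: "(\<integral>\<^sup>+z. ennreal (if (N z)\<^sup>2 \<le> s then exp (- s) else 0) \<partial>lborel) =
      ennreal (indicator {0..} s * s powr (1 + ?n / 2 - 1) / exp s) * emeasure lborel L"
    if "s \<noteq> 0" for s :: real
  proof (cases "s > 0")
    case True
    have "(N z)\<^sup>2 \<le> s \<longleftrightarrow> z /\<^sub>R sqrt s \<in> L" for z
    proof -
      have "(N z)\<^sup>2 \<le> s \<longleftrightarrow> N z \<le> sqrt s"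
        using nonneg[of z] True by (metis abs_of_nonneg real_le_rsqrt real_sqrt_abs real_sqrt_le_iff)
      then show ?thesis using sublevel[of "sqrt s" z] True by simp
    qed
    then have "(\<integral>\<^sup>+z. ennreal (if (N z)\<^sup>2 \<le> s then exp (- s) else 0) \<partial>lborel) =
        (\<integral>\<^sup>+z. ennreal (exp (- s)) * indicator {z. z /\<^sub>R sqrt s \<in> L} z \<partial>lborel)"
      by (intro nn_integral_cong) (auto simp: indicator_def)
    also have "\<dots> = ennreal (exp (- s)) * emeasure lborel {z. z /\<^sub>R sqrt s \<in> L}"
      by (subst nn_integral_cmult_indicator) simp_all
    also have "\<dots> = ennreal (exp (- s)) * (ennreal (sqrt s ^ DIM('a)) * emeasure lborel L)"
      using True by (subst emeasure_lborel_scaled_preimage) simp_all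
    also have "sqrt s ^ DIM('a) = s powr (?n / 2)"
      using True by (simp add: powr_half_sqrt[symmetric] powr_powr flip: powr_realpow)
    finally show ?thesis
      using True by (simp add: mult.assoc[symmetric] exp_minus field_simps flip: ennreal_mult')
  \<comment> \<open>For \<open>s < 0\<close> both sides vanish: no square lies below
    \<open>s\<close>, and the indicator of \<open>{0..}\<close> is 0.\<close>
  next
    case False
    then have "\<not> (N z)\<^sup>2 \<le> s" for z
      using that by (meson dual_order.trans linorder_neqE_linordered_idom not_less zero_le_power2)
    then show ?thesis using False that by simp
  qed
  have "(\<integral>\<^sup>+z. ennreal (exp (- (N z)\<^sup>2)) \<partial>lborel) =
      (\<integral>\<^sup>+z. \<integral>\<^sup>+s. ennreal (if (N z)\<^sup>2 \<le> s then exp (- s) else 0) \<partial>lborel \<partial>lborel)"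
    by (simp add: nn_integral_exp_minus_atLeast)
  also have "\<dots> = (\<integral>\<^sup>+s. \<integral>\<^sup>+z. ennreal (if (N z)\<^sup>2 \<le> s then exp (- s) else 0) \<partial>lborel \<partial>lborel)"
    by (rule lborel_pair.Fubini'[symmetric]) measurable
  also have "\<dots> = (\<integral>\<^sup>+s. ennreal (indicator {0..} s * s powr (1 + ?n / 2 - 1) / exp s)
      * emeasure lborel L \<partial>lborel)"
    using AE_lborel_singleton[of "0::real"]
    by (intro nn_integral_cong_AE) (auto elim!: eventually_mono dest: slice)
  also have "\<dots> = ennreal (Gamma (1 + ?n / 2)) * emeasure lborel L"
    by (subst Gamma_conv_nn_integral_real) (simp_all add: nn_integral_multc add_pos_nonneg)
  finally show ?thesis .
qed

section \<open>The gauge of a symmetric convex body\<close>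

lemma zero_in_interior_symmetric_convex:
  fixes K :: "'a::euclidean_space set"
  assumes "convex K" and sym: "\<forall>z\<in>K. - z \<in> K" and "interior K \<noteq> {}"
  shows "0 \<in> interior K"
proof -
  obtain z where z: "z \<in> interior K" using assms by auto
  have "uminus ` K = K"
    using sym by (metis (no_types, lifting) add.inverse_inverse image_eqI image_subset_iff
        subsetI subset_antisym)
  then have "- z \<in> interior K"
    using z interior_negations[of K] by (metis image_eqI)
  \<comment> \<open>The origin is the midpoint of an interior point and its mirror image, and the
    interior is convex.\<close>
  then have "(1/2) *\<^sub>R z + (1/2) *\<^sub>R (- z) \<in> interior K"
    using convex_interior[OF \<open>convex K\<close>] z by (intro convexD) auto
  then show ?thesis by simp
qed

text \<open>The admissible scalars form an up-closed set by convexity, a nonempty one because a ball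
  around 0 lies in \<open>K\<close>, and closedness of \<open>K\<close> carries membership to the
  infimum when that is positive.\<close>

lemma minkowski_functional_props:
  fixes K :: "(real ^ 'n) set"
  assumes "closed K" "convex K" and int: "0 \<in> interior K"
  shows minkowski_functional_nonneg: "minkowski_functional K z \<ge> 0"
    and minkowski_functional_le_iff:
      "t > 0 \<Longrightarrow> minkowski_functional K z \<le> t \<longleftrightarrow> z /\<^sub>R t \<in> K"
proof -
  define S where "S = {t. t > 0 \<and> z /\<^sub>R t \<in> K}"
  have mono: "s \<in> S" if "t \<in> S" "t \<le> s" for s t
  proof -
    \<comment> \<open>The point \<open>z /\<^sub>R s\<close> lies on the segment from 0 to
      \<open>z /\<^sub>R t\<close>.\<close>
    have "(t/s) *\<^sub>R (z /\<^sub>R t) + (1 - t/s) *\<^sub>R 0 \<in> K"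
      using that \<open>convex K\<close> int interior_subset[of K]
      by (intro convexD) (auto simp: S_def divide_simps)
    then show ?thesis using that by (simp add: S_def field_simps)
  qed
  obtain e where e: "e > 0" "ball 0 e \<subseteq> K" using int by (auto simp: mem_interior)
  \<comment> \<open>The summand 1 puts the scaled point strictly inside the ball and keeps the
    scalar positive when \<open>z = 0\<close>.\<close>
  have "(norm z + 1) / e \<in> S"
  proof -
    have "norm (z /\<^sub>R ((norm z + 1) / e)) < e"
      using e by (simp add: field_simps add_pos_nonneg)
    then show ?thesis using e by (auto simp: S_def subset_iff intro!: divide_pos_pos add_nonneg_pos)
  qed
  then have ne: "S \<noteq> {}" by auto
  have bdd: "bdd_below S" by (auto simp: S_def intro!: bdd_belowI[of _ 0])
  have mf: "minkowski_functional K z = Inf S" by (simp add: minkowski_functional_def S_def)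
  show "minkowski_functional K z \<ge> 0"
    unfolding mf using ne by (intro cInf_greatest) (auto simp: S_def)
  show "minkowski_functional K z \<le> t \<longleftrightarrow> z /\<^sub>R t \<in> K" if t: "t > 0"
  proof
    assume "z /\<^sub>R t \<in> K"
    then show "minkowski_functional K z \<le> t"
      unfolding mf using t bdd by (intro cInf_lower) (auto simp: S_def)
  next
    assume le: "minkowski_functional K z \<le> t"
    \<comment> \<open>When \<open>t\<close> equals the infimum, its membership in \<open>S\<close>
      is not yet known, so \<open>t\<close> is approached from above through scalars that do belong
      to \<open>S\<close>.\<close>
    have "z /\<^sub>R (t + 1 / Suc n) \<in> K" for n
    proof -
      have "Inf S < t + 1 / Suc n" using le mf
        by (smt (verit) divide_pos_pos of_nat_0_less_iff zero_less_Suc)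
      then obtain s where "s \<in> S" "s < t + 1 / Suc n" using ne by (metis cInf_lessD)
      then show ?thesis using mono[of s "t + 1 / Suc n"] by (auto simp: S_def)
    qed
    moreover have "(\<lambda>n. z /\<^sub>R (t + 1 / Suc n)) \<longlonglongrightarrow> z /\<^sub>R (t + 0)"
      using t LIMSEQ_Suc[OF lim_1_over_n] by (intro tendsto_intros) auto
    ultimately show "z /\<^sub>R t \<in> K"
      using closed_sequentially[OF \<open>closed K\<close>] by fastforce
  qed
qed

text \<open>A sublevel set at a positive level is a dilate of \<open>K\<close>; level 0 is a
  countable intersection of these, and negative levels are empty.\<close>

lemma minkowski_functional_measurable:
  fixes K :: "(real ^ 'n) set"
  assumes "closed K" "convex K" "0 \<in> interior K"
  shows "minkowski_functional K \<in> borel_measurable borel"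
proof -
  note nn = minkowski_functional_nonneg[OF assms] and le = minkowski_functional_le_iff[OF assms]
  have [measurable]: "K \<in> sets borel" using assms(1) by (rule borel_closed)
  have pos: "{z. minkowski_functional K z \<le> a} \<in> sets borel" if "a > 0" for a
    unfolding le[OF that] by measurable
  have "{z. minkowski_functional K z \<le> a} \<in> sets borel" for a
  proof -
    consider "a > 0" | "a = 0" | "a < 0" by linarith
    then show ?thesis
    proof cases
      case 2
      have "minkowski_functional K z \<le> 0 \<longleftrightarrow> (\<forall>n. minkowski_functional K z \<le> 1 / Suc n)" for z
      proof
        assume "\<forall>n. minkowski_functional K z \<le> 1 / Suc n"
        then show "minkowski_functional K z \<le> 0"
          using LIMSEQ_le_const[OF LIMSEQ_Suc[OF lim_1_over_n]] by blast
      qed (smt (verit) divide_nonneg_nonneg of_nat_0_le_iff)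
      then have "{z. minkowski_functional K z \<le> a} = (\<Inter>n. {z. minkowski_functional K z \<le> 1 / Suc n})"
        using 2 by auto
      then show ?thesis using pos by (auto intro!: sets.countable_INT)
    next
      case 3
      then have "{z. minkowski_functional K z \<le> a} = {}"
        by (smt (verit) Collect_empty_eq nn)
      then show ?thesis by simp
    qed (rule pos)
  qed
  then show ?thesis by (simp add: borel_measurable_iff_le)
qed

section \<open>The density and its product with F\<close>

lemma gauge_gaussian_unfold:
  "gauge_gaussian K D \<xi> =
    exp (- (minkowski_functional K \<xi> / sqrt 2)\<^sup>2) / ((2 * pi) powr (real CARD('n) / 2) * D)"
  for \<xi> :: "real ^ 'n"
  by (simp add: gauge_gaussian_def power_divide)

text \<open>The two half squares of the gauge cancel in the exponent, as do the power of 2 pi and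
  the normalizer, which is nonzero by assumption.\<close>

lemma F_integrand_mult_p_tilde:
  fixes \<xi> :: "real ^ 'n"
  assumes "normalizer K > 0"
  shows "F_integrand K x \<xi> * p_tilde K \<xi> =
    C_vol K * exp (- max (\<bar>\<xi> \<bullet> x\<bar>\<^sup>2) ((minkowski_functional K \<xi>)\<^sup>2))"
proof -
  define g where "g = (minkowski_functional K \<xi>)\<^sup>2"
  define m where "m = max (\<bar>\<xi> \<bullet> x\<bar>\<^sup>2) g"
  define w where "w = (2 * pi) powr (real CARD('n) / 2)"
  have "w > 0" by (simp add: w_def)
  moreover have "exp (- m + 1 / 2 * g) * exp (- g / 2) = exp (- m)"
    by (simp flip: exp_add)
  ultimately show ?thesis using assms
    unfolding F_integrand_def p_tilde_def gauge_gaussian_def C_body_def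
      g_def[symmetric] m_def[symmetric] w_def[symmetric] by simp
qed

theorem theorem1:
  fixes K :: "(real ^ 'n) set"
    and M :: "'w measure"
    and \<zeta> :: "'w \<Rightarrow> real ^ 'n"
    and x :: "real ^ 'n"
  assumes "compact K" and "convex K" and "\<forall>z\<in>K. - z \<in> K"
    and "prob_space M"
    and "distributed M lborel \<zeta> (\<lambda>z. indicator K z / measure lborel K)"
  shows "(\<exists>!D. is_normalizer K D)
    \<and> \<P>(\<omega> in M. \<zeta> \<omega> \<in> feasible_set K x)
        = prob_space.expectation (density lborel (\<lambda>\<xi>. ennreal (p_tilde K \<xi>))) (F_integrand K x)
    \<and> prob_space.expectation (density lborel (\<lambda>\<xi>. ennreal (p_tilde K \<xi>))) (F_integrand K x)
        = (\<integral>\<xi>. F_integrand K x \<xi> * p_tilde K \<xi> \<partial>lborel)"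
proof -
  define V where "V = measure lborel K"
  define G where "G = Gamma (1 + real CARD('n) / 2)"
  let ?N = "minkowski_functional K"
  let ?A = "feasible_set K x"
  have G: "G > 0" unfolding G_def by (intro Gamma_real_pos) (simp add: add_pos_nonneg)
  have "closed K" using assms(1) by (rule compact_imp_closed)
  then have K[measurable]: "K \<in> sets borel" by (rule borel_closed)
  have K_fin: "emeasure lborel K < \<infinity>"
    using emeasure_bounded_finite[OF compact_imp_bounded[OF assms(1)]] .
  have emK: "emeasure lborel K = ennreal V"
    using K_fin by (simp add: V_def emeasure_eq_ennreal_measure top.not_eq_extremum)
  have prob: "emeasure M (\<zeta> -` B \<inter> space M) = emeasure lborel (B \<inter> K) / ennreal V"
    if [measurable]: "B \<in> sets borel" and "V > 0" for B
  proof -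
    have "emeasure M (\<zeta> -` B \<inter> space M) =
        (\<integral>\<^sup>+z. ennreal (indicator K z / V) * indicator B z \<partial>lborel)"
      using distributed_emeasure[OF assms(5), of B] by (simp add: V_def)
    also have "\<dots> = (\<integral>\<^sup>+z. indicator (B \<inter> K) z / ennreal V \<partial>lborel)"
      using \<open>V > 0\<close>
      by (intro nn_integral_cong) (auto simp: indicator_def divide_ennreal[symmetric])
    also have "\<dots> = emeasure lborel (B \<inter> K) / ennreal V"
      by (simp add: nn_integral_divide)
    finally show ?thesis .
  qed
  \<comment> \<open>Division by zero yields 0, so with \<open>V = 0\<close> the density would vanish
    and \<open>M\<close> would have total mass 0.\<close>
  have V: "V > 0"
  proof (rule ccontr)
    assume "\<not> V > 0"
    then have "V = 0" by (simp add: V_def order.antisym)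
    then have "emeasure M (\<zeta> -` UNIV \<inter> space M) = 0"
      using distributed_emeasure[OF assms(5), of UNIV] by (simp add: V_def)
    then show False using prob_space.emeasure_space_1[OF assms(4)] by simp
  qed
  \<comment> \<open>A convex set with empty interior is negligible, so positive volume provides an
    interior point, and symmetry then puts 0 in the interior.\<close>
  have "\<not> negligible K"
  proof
    assume "negligible K"
    then have "emeasure lborel K = 0"
      by (simp add: negligible_iff_emeasure0)
    then show False using V emK by simp
  qed
  then have int: "0 \<in> interior K"
    using zero_in_interior_symmetric_convex assms negligible_convex_interior by blast
  note nn = minkowski_functional_nonneg[OF \<open>closed K\<close> assms(2) int]
    and le = minkowski_functional_le_iff[OF \<open>closed K\<close> assms(2) int]
    and [measurable] = minkowski_functional_measurable[OF \<open>closed K\<close> assms(2) int]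

  \<comment> \<open>Dividing the gauge by \<open>sqrt 2\<close> dilates its unit ball by
    \<open>sqrt 2\<close>, hence the factor \<open>sqrt 2 ^ CARD('n)\<close> in the volume.\<close>
  have "(\<integral>\<^sup>+z. ennreal (exp (- (?N z / sqrt 2)\<^sup>2)) \<partial>lborel) =
      ennreal G * emeasure lborel {z. z /\<^sub>R sqrt 2 \<in> K}"
    unfolding G_def
  proof (subst nn_integral_exp_minus_gauge_square[where L = "{z. z /\<^sub>R sqrt 2 \<in> K}"])
    show "?N z / sqrt 2 \<le> t \<longleftrightarrow> z /\<^sub>R t \<in> {z. z /\<^sub>R sqrt 2 \<in> K}" if "t > 0" for t z
      using le[of "t * sqrt 2" z] that by (simp add: field_simps)
  qed (use nn in simp_all)
  also have "\<dots> = ennreal (G * (sqrt 2 ^ CARD('n) * V))"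
    using G V by (simp add: emeasure_lborel_scaled_preimage emK ennreal_mult)
  finally have norm_int: "(\<integral>z. exp (- (?N z / sqrt 2)\<^sup>2) \<partial>lborel) = G * (sqrt 2 ^ CARD('n) * V)"
    using G V by (subst integral_eq_nn_integral) simp_all
  define I where "I = G * (sqrt 2 ^ CARD('n) * V)"
  define w where "w = (2 * pi) powr (real CARD('n) / 2)"
  have I: "I > 0" using G V by (simp add: I_def)
  have w: "w > 0" by (simp add: w_def)
  \<comment> \<open>The integral is \<open>I / (w * D)\<close>, which equals 1 for exactly one
    \<open>D\<close>; this gives the definite description its meaning.\<close>
  have "is_normalizer K D \<longleftrightarrow> D = I / w" for D
  proof -
    have "(\<integral>\<xi>. gauge_gaussian K D \<xi> \<partial>lborel) = I / (w * D)"
      unfolding gauge_gaussian_unfold w_def[symmetric] integral_divide_zero norm_int I_def ..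
    then show ?thesis
      using I w by (auto simp: is_normalizer_def field_simps zero_less_mult_iff)
  qed
  then have ex1: "\<exists>!D. is_normalizer K D" and "normalizer K = I / w"
    by (auto simp: normalizer_def)
  then have D: "normalizer K > 0" using I w by simp

  have A: "?A = {z \<in> K. \<bar>z \<bullet> x\<bar> \<le> 1}"
    by (auto simp: feasible_set_def constraint_fun_def abs_square_le_1)
  have [measurable]: "?A \<in> sets borel" unfolding A by measurable
  have A_fin: "emeasure lborel ?A = ennreal (measure lborel ?A)"
    using K_fin emeasure_mono[of ?A K lborel]
    by (intro emeasure_eq_ennreal_measure) (auto simp: A top_unique)

  \<comment> \<open>Both entries are nonnegative, so squaring commutes with the maximum.\<close>
  have max_sq: "max (\<bar>z \<bullet> x\<bar>\<^sup>2) ((?N z)\<^sup>2) = (max \<bar>z \<bullet> x\<bar> (?N z))\<^sup>2" for z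
    using nn[of z] by (auto simp: max_def power2_le_iff_abs_le abs_le_square_iff)
  have "(\<integral>\<^sup>+z. ennreal (exp (- (max \<bar>z \<bullet> x\<bar> (?N z))\<^sup>2)) \<partial>lborel) =
      ennreal G * emeasure lborel ?A"
    unfolding G_def
  proof (subst nn_integral_exp_minus_gauge_square[where L = ?A])
    \<comment> \<open>The maximum is at most \<open>t\<close> when \<open>z /\<^sub>R t\<close> lies
      both in \<open>K\<close> and in the slab where the inner product with \<open>x\<close> is at
      most 1 in absolute value; together these are the feasible set.\<close>
    show "max \<bar>z \<bullet> x\<bar> (?N z) \<le> t \<longleftrightarrow> z /\<^sub>R t \<in> ?A" if "t > 0" for t z
      using le[of t z] that by (auto simp: A abs_mult field_simps)
  qed (use nn in \<open>simp_all add: le_max_iff_disj\<close>)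
  then have "(\<integral>z. exp (- (max \<bar>z \<bullet> x\<bar> (?N z))\<^sup>2) \<partial>lborel) = G * measure lborel ?A"
    using G by (subst integral_eq_nn_integral) (simp_all add: A_fin flip: ennreal_mult)
  \<comment> \<open>The Gamma factor of the integral cancels against the one in
    \<open>C_vol\<close>, leaving a ratio of volumes.\<close>
  then have rhs: "(\<integral>\<xi>. F_integrand K x \<xi> * p_tilde K \<xi> \<partial>lborel) = measure lborel ?A / V"
    unfolding F_integrand_mult_p_tilde[OF D] max_sq integral_mult_right_zero
    using G by (simp add: C_vol_def V_def G_def[symmetric])

  have "emeasure M (\<zeta> -` ?A \<inter> space M) = ennreal (measure lborel ?A / V)"
    using V by (subst prob) (simp_all add: Int_absorb2 A A_fin[unfolded A] divide_ennreal)
  moreover have "{\<omega> \<in> space M. \<zeta> \<omega> \<in> ?A} = \<zeta> -` ?A \<inter> space M" by auto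
  ultimately have lhs: "\<P>(\<omega> in M. \<zeta> \<omega> \<in> ?A) = measure lborel ?A / V"
    using V by (simp add: measure_def)

  have [measurable]: "p_tilde K \<in> borel_measurable borel" "F_integrand K x \<in> borel_measurable borel"
    unfolding p_tilde_def gauge_gaussian_def F_integrand_def by measurable
  have "integral\<^sup>L (density lborel (\<lambda>\<xi>. ennreal (p_tilde K \<xi>))) (F_integrand K x)
        = (\<integral>\<xi>. F_integrand K x \<xi> * p_tilde K \<xi> \<partial>lborel)"
  proof (subst integral_density)
    \<comment> \<open>Nonnegativity, from the positive normalizer, is what lets the density pass
      through \<open>ennreal\<close> unchanged.\<close>
    show "AE \<xi> in lborel. 0 \<le> p_tilde K \<xi>"
      using D by (simp add: p_tilde_def gauge_gaussian_def)
  qed (simp_all add: mult.commute)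
  with ex1 lhs rhs show ?thesis by simp
qed

end
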